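(* Let $X$ be a lattice-ordered group and let $H, K$ be ideals of $X$. Then $[H,K]_X = H\cap K$, where $[H,K]_X$ denotes the Huq commutator of $H$ and $K$ in $X$.
   Context: A lattice-ordered group is an algebra $(X,\cdot,e,(-)^{-1},\lor)$ such that $(X,\cdot,e,(-)^{-1})$ is a group, $(X,\lor)$ is a semilattice ($\lor$ is associative, commutative, idempotent), and $x(y\lor z)=xy\lor xz$, $(x\lor y)z=xz\lor yz$ for all $x,y,z$. Morphisms are the maps preserving the group product and $\lor$; this defines the category $\ell\mathbb{G}rp$. The order is $x\le y\iff x\lor y=y$. An ideal (normal subobject) of $X$ is a subobject that is the kernel of some morphism; equivalently, a subalgebra that is normal as a subgroup and convex (if $a\le x\le b$ with $a,b$ in it and $x\in X$, then $x$ is in it). Two subobjects $A,B$ of $Y$ cooperate if there is a morphism $\varphi\colon A\times B\to Y$ of lattice-ordered groups (necessarily unique) with $\varphi(a,e)=a$ and $\varphi(e,b)=b$ for all $a\in A$, $b\in B$. The Huq commutator $[A,B]_X$ of subobjects $A,B$ of $X$ is the smallest normal subobject of $X$ such that the images of $A$ and $B$ cooperate in the quotient $X/[A,B]_X$. *)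

theory Defs
  imports "HOL-Algebra.Coset"
begin

section \<open>Lattice-ordered groups, ideals, cooperation and the Huq commutator\<close>

record 'a lgroup = "'a monoid" +
  ljoin :: "'a \<Rightarrow> 'a \<Rightarrow> 'a"  (infixl \<open>\<Or>\<index>\<close> 65)

locale lattice_ordered_group = group X for X (structure) +
  assumes join_closed [simp, intro]:
      "\<lbrakk>x \<in> carrier X; y \<in> carrier X\<rbrakk> \<Longrightarrow> x \<Or> y \<in> carrier X"
    and join_assoc:
      "\<lbrakk>x \<in> carrier X; y \<in> carrier X; z \<in> carrier X\<rbrakk> \<Longrightarrow> (x \<Or> y) \<Or> z = x \<Or> (y \<Or> z)"
    and join_comm:
      "\<lbrakk>x \<in> carrier X; y \<in> carrier X\<rbrakk> \<Longrightarrow> x \<Or> y = y \<Or> x"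
    and join_idem [simp]:
      "x \<in> carrier X \<Longrightarrow> x \<Or> x = x"
    and mult_join:
      "\<lbrakk>x \<in> carrier X; y \<in> carrier X; z \<in> carrier X\<rbrakk> \<Longrightarrow> x \<otimes> (y \<Or> z) = (x \<otimes> y) \<Or> (x \<otimes> z)"
    and join_mult:
      "\<lbrakk>x \<in> carrier X; y \<in> carrier X; z \<in> carrier X\<rbrakk> \<Longrightarrow> (x \<Or> y) \<otimes> z = (x \<otimes> z) \<Or> (y \<otimes> z)"

definition lg_le :: "('a, 'm) lgroup_scheme \<Rightarrow> 'a \<Rightarrow> 'a \<Rightarrow> bool" where
  "lg_le X x y \<longleftrightarrow> x \<Or>\<^bsub>X\<^esub> y = y"

definition lg_hom :: "('a, 'm) lgroup_scheme \<Rightarrow> ('b, 'n) lgroup_scheme \<Rightarrow> ('a \<Rightarrow> 'b) set" where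
  "lg_hom X Y =
    {h \<in> hom X Y. \<forall>x \<in> carrier X. \<forall>y \<in> carrier X. h (x \<Or>\<^bsub>X\<^esub> y) = h x \<Or>\<^bsub>Y\<^esub> h y}"

definition lg_subalgebra :: "'a set \<Rightarrow> ('a, 'm) lgroup_scheme \<Rightarrow> bool" where
  "lg_subalgebra A X \<longleftrightarrow> subgroup A X \<and> (\<forall>a \<in> A. \<forall>b \<in> A. a \<Or>\<^bsub>X\<^esub> b \<in> A)"

text \<open>Ideals are the normal subobjects. The equivalence with being the kernel of a morphism is
  proved below: \<open>kernel_lg_ideal\<close> covers codomains over an arbitrary type, and
  \<open>lg_ideal_iff_kernel\<close> shows that codomains over the type of cosets suffice.\<close>

definition lg_ideal :: "'a set \<Rightarrow> ('a, 'm) lgroup_scheme \<Rightarrow> bool" where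
  "lg_ideal N X \<longleftrightarrow> lg_subalgebra N X \<and> N \<lhd> X \<and>
    (\<forall>a \<in> N. \<forall>b \<in> N. \<forall>x \<in> carrier X. lg_le X a x \<and> lg_le X x b \<longrightarrow> x \<in> N)"

definition lg_prod :: "('a, 'm) lgroup_scheme \<Rightarrow> ('b, 'n) lgroup_scheme \<Rightarrow> ('a \<times> 'b) lgroup" where
  "lg_prod X Y =
    \<lparr>carrier = carrier X \<times> carrier Y,
     mult = (\<lambda>(a, b) (a', b'). (a \<otimes>\<^bsub>X\<^esub> a', b \<otimes>\<^bsub>Y\<^esub> b')),
     one = (\<one>\<^bsub>X\<^esub>, \<one>\<^bsub>Y\<^esub>),
     ljoin = (\<lambda>(a, b) (a', b'). (a \<Or>\<^bsub>X\<^esub> a', b \<Or>\<^bsub>Y\<^esub> b'))\<rparr>"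

text \<open>The library's quotient group, with cosets joined elementwise. For an ideal \<open>N\<close> the join of
  the cosets of \<open>a\<close> and \<open>b\<close> is the coset of their join (\<open>rcos_join\<close> below).\<close>

definition lg_quot :: "('a, 'm) lgroup_scheme \<Rightarrow> 'a set \<Rightarrow> 'a set lgroup" where
  "lg_quot X N =
    \<lparr>carrier = carrier (X Mod N),
     mult = mult (X Mod N),
     one = one (X Mod N),
     ljoin = (\<lambda>U V. {u \<Or>\<^bsub>X\<^esub> v | u v. u \<in> U \<and> v \<in> V})\<rparr>"

definition lg_cooperate :: "'a set \<Rightarrow> 'a set \<Rightarrow> ('a, 'm) lgroup_scheme \<Rightarrow> bool" where
  "lg_cooperate A B Y \<longleftrightarrow>
    (\<exists>\<phi> \<in> lg_hom (lg_prod (Y\<lparr>carrier := A\<rparr>) (Y\<lparr>carrier := B\<rparr>)) Y.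
      (\<forall>a \<in> A. \<phi> (a, \<one>\<^bsub>Y\<^esub>) = a) \<and> (\<forall>b \<in> B. \<phi> (\<one>\<^bsub>Y\<^esub>, b) = b))"

definition cooperate_modulo :: "('a, 'm) lgroup_scheme \<Rightarrow> 'a set \<Rightarrow> 'a set \<Rightarrow> 'a set \<Rightarrow> bool" where
  "cooperate_modulo X A B N \<longleftrightarrow>
    lg_cooperate ((\<lambda>a. N #>\<^bsub>X\<^esub> a) ` A) ((\<lambda>b. N #>\<^bsub>X\<^esub> b) ` B) (lg_quot X N)"

text \<open>The \<open>LEAST\<close> is with respect to inclusion. It is attained for all subalgebras \<open>A\<close> and \<open>B\<close>
  of a lattice-ordered group, see \<open>huq_commutator_least\<close>.\<close>

definition huq_commutator :: "('a, 'm) lgroup_scheme \<Rightarrow> 'a set \<Rightarrow> 'a set \<Rightarrow> 'a set" where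
  "huq_commutator X A B = (LEAST N. lg_ideal N X \<and> cooperate_modulo X A B N)"


section \<open>The quotient by an ideal is a lattice-ordered group\<close>

lemma lg_quot_simps [simp]:
  "carrier (lg_quot X N) = rcosets\<^bsub>X\<^esub> N"
  "mult (lg_quot X N) = set_mult X"
  "one (lg_quot X N) = N"
  "ljoin (lg_quot X N) = (\<lambda>U V. {u \<Or>\<^bsub>X\<^esub> v | u v. u \<in> U \<and> v \<in> V})"
  by (simp_all add: lg_quot_def FactGroup_def)

context lattice_ordered_group
begin

lemma rcos_eq_iff:
  assumes "subgroup N X" "x \<in> carrier X" "y \<in> carrier X"
  shows "N #> x = N #> y \<longleftrightarrow> x \<otimes> inv y \<in> N"
proof -
  have c: "x \<otimes> inv y \<in> carrier X" and N: "N \<subseteq> carrier X"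
    using assms(2,3) subgroup.subset[OF assms(1)] by simp_all
  show ?thesis
    using coset_mult_inv1[OF _ assms(2,3) N] coset_mult_inv2[OF _ assms(2,3) N]
      coset_join1[OF _ c assms(1)] coset_join2[OF c assms(1)] by blast
qed

lemma le_trans:
  assumes "x \<in> carrier X" "y \<in> carrier X" "z \<in> carrier X" "lg_le X x y" "lg_le X y z"
  shows "lg_le X x z"
proof -
  have "x \<Or> z = x \<Or> (y \<Or> z)"
    using assms(5) by (simp add: lg_le_def)
  also have "\<dots> = (x \<Or> y) \<Or> z"
    using assms by (simp only: join_assoc)
  also have "\<dots> = z"
    using assms by (simp add: lg_le_def)
  finally show ?thesis
    by (simp add: lg_le_def)
qed

lemma le_join1: "\<lbrakk>x \<in> carrier X; y \<in> carrier X\<rbrakk> \<Longrightarrow> lg_le X x (x \<Or> y)"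
  by (simp add: lg_le_def join_assoc[symmetric])

lemma le_join2: "\<lbrakk>x \<in> carrier X; y \<in> carrier X\<rbrakk> \<Longrightarrow> lg_le X y (x \<Or> y)"
  using le_join1[of y x] by (simp add: join_comm)

lemma join_least:
  assumes "x \<in> carrier X" "y \<in> carrier X" "z \<in> carrier X" "lg_le X x z" "lg_le X y z"
  shows "lg_le X (x \<Or> y) z"
  using assms unfolding lg_le_def by (simp add: join_assoc)

lemma le_multr:
  assumes "x \<in> carrier X" "y \<in> carrier X" "z \<in> carrier X" "lg_le X x y"
  shows "lg_le X (x \<otimes> z) (y \<otimes> z)"
  using assms by (simp add: lg_le_def join_mult[symmetric])

lemma le_multl:
  assumes "x \<in> carrier X" "y \<in> carrier X" "z \<in> carrier X" "lg_le X x y"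
  shows "lg_le X (z \<otimes> x) (z \<otimes> y)"
  using assms by (simp add: lg_le_def mult_join[symmetric])

lemma le_inv:
  assumes x: "x \<in> carrier X" and y: "y \<in> carrier X" and le: "lg_le X x y"
  shows "lg_le X (inv y) (inv x)"
proof -
  have "lg_le X (inv y \<otimes> x \<otimes> inv x) (inv y \<otimes> y \<otimes> inv x)"
    using x y le by (intro le_multr le_multl) auto
  then show ?thesis
    using x y by (simp add: m_assoc)
qed

lemma join_mono:
  assumes c: "a \<in> carrier X" "b \<in> carrier X" "c \<in> carrier X" "d \<in> carrier X"
    and "lg_le X a c" "lg_le X b d"
  shows "lg_le X (a \<Or> b) (c \<Or> d)"
proof (rule join_least)
  show "lg_le X a (c \<Or> d)"
    using assms by (intro le_trans[of a c "c \<Or> d"] le_join1) auto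
  show "lg_le X b (c \<Or> d)"
    using assms by (intro le_trans[of b d "c \<Or> d"] le_join2) auto
qed (use c in auto)

lemma ideal_join_cong:
  assumes N: "lg_ideal N X" and a: "a \<in> carrier X" and b: "b \<in> carrier X"
    and n: "n \<in> N" and m: "m \<in> N"
  shows "(n \<otimes> a \<Or> m \<otimes> b) \<otimes> inv (a \<Or> b) \<in> N"
proof -
  have sub: "subgroup N X" and j: "\<And>x y. \<lbrakk>x \<in> N; y \<in> N\<rbrakk> \<Longrightarrow> x \<Or> y \<in> N"
    using N unfolding lg_ideal_def lg_subalgebra_def by blast+
  have conv: "x \<in> N" if "u \<in> N" "v \<in> N" "x \<in> carrier X" "lg_le X u x" "lg_le X x v" for u v x
    using N that unfolding lg_ideal_def by blast
  have car: "\<And>x. x \<in> N \<Longrightarrow> x \<in> carrier X" and i: "\<And>x. x \<in> N \<Longrightarrow> inv x \<in> N"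
    using sub by (auto intro: subgroup.mem_carrier subgroup.m_inv_closed)
  define k where "k = n \<Or> m"
  define l where "l = inv (inv n \<Or> inv m)"
  have k: "k \<in> N" and l: "l \<in> N"
    unfolding k_def l_def using n m i j by auto
  note cs = car[OF n] car[OF m] car[OF k] car[OF l] a b
  have "lg_le X l (inv (inv n))" "lg_le X l (inv (inv m))"
    unfolding l_def using cs(1,2) by (intro le_inv le_join1 le_join2; simp)+
  then have ln: "lg_le X l n" "lg_le X l m"
    using cs by auto
  have kn: "lg_le X n k" "lg_le X m k"
    unfolding k_def using cs by (auto intro: le_join1 le_join2)
  have "lg_le X (l \<otimes> (a \<Or> b)) (n \<otimes> a \<Or> m \<otimes> b)"
    using cs ln by (simp add: mult_join join_mono le_multr)
  then have "lg_le X (l \<otimes> (a \<Or> b) \<otimes> inv (a \<Or> b)) ((n \<otimes> a \<Or> m \<otimes> b) \<otimes> inv (a \<Or> b))"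
    using cs by (intro le_multr) auto
  then have 1: "lg_le X l ((n \<otimes> a \<Or> m \<otimes> b) \<otimes> inv (a \<Or> b))"
    using cs by (simp add: m_assoc)
  have "lg_le X (n \<otimes> a \<Or> m \<otimes> b) (k \<otimes> (a \<Or> b))"
    using cs kn by (simp add: mult_join join_mono le_multr)
  then have "lg_le X ((n \<otimes> a \<Or> m \<otimes> b) \<otimes> inv (a \<Or> b)) (k \<otimes> (a \<Or> b) \<otimes> inv (a \<Or> b))"
    using cs by (intro le_multr) auto
  then have 2: "lg_le X ((n \<otimes> a \<Or> m \<otimes> b) \<otimes> inv (a \<Or> b)) k"
    using cs by (simp add: m_assoc)
  show ?thesis
    using cs by (intro conv[OF l k _ 1 2]) auto
qed

lemma rcos_join:
  assumes N: "lg_ideal N X" and a: "a \<in> carrier X" and b: "b \<in> carrier X"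
  shows "{u \<Or> v | u v. u \<in> N #> a \<and> v \<in> N #> b} = N #> (a \<Or> b)"
proof (intro equalityI subsetI)
  have sub: "subgroup N X"
    using N by (simp add: lg_ideal_def lg_subalgebra_def)
  note car = subgroup.mem_carrier[OF sub]
  {
    fix x assume "x \<in> {u \<Or> v | u v. u \<in> N #> a \<and> v \<in> N #> b}"
    then obtain n m where nm: "n \<in> N" "m \<in> N" and x: "x = n \<otimes> a \<Or> m \<otimes> b"
      by (auto simp: r_coset_def)
    have "N #> x = N #> (a \<Or> b)"
      using ideal_join_cong[OF N a b nm] nm car a b by (subst rcos_eq_iff[OF sub]) (auto simp: x)
    moreover have "x \<in> N #> x"
      using nm car a b by (intro rcos_self[OF _ sub]) (auto simp: x)
    ultimately show "x \<in> N #> (a \<Or> b)" by simp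
  next
    fix x assume "x \<in> N #> (a \<Or> b)"
    then obtain n where n: "n \<in> N" and x: "x = n \<otimes> (a \<Or> b)"
      by (auto simp: r_coset_def)
    then have "x = n \<otimes> a \<Or> n \<otimes> b"
      using car a b by (simp add: mult_join)
    then show "x \<in> {u \<Or> v | u v. u \<in> N #> a \<and> v \<in> N #> b}"
      using n by (auto simp: r_coset_def)
  }
qed

lemma lg_quot_lattice_ordered_group:
  assumes N: "lg_ideal N X"
  shows "lattice_ordered_group (lg_quot X N)"
proof -
  interpret N: normal N X
    using N by (simp add: lg_ideal_def)
  have "group (X Mod N)"
    by (rule N.factorgroup_is_group)
  then have "group (lg_quot X N)"
    by (simp add: group_def group_axioms_def monoid_def Units_def FactGroup_def)
  moreover have "carrier (lg_quot X N) = (\<lambda>a. N #> a) ` carrier X"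
    by (auto simp: RCOSETS_def)
  moreover have "(N #> a) \<Or>\<^bsub>lg_quot X N\<^esub> (N #> b) = N #> (a \<Or> b)"
    and "(N #> a) \<otimes>\<^bsub>lg_quot X N\<^esub> (N #> b) = N #> (a \<otimes> b)"
    if "a \<in> carrier X" "b \<in> carrier X" for a b
    using that by (simp_all add: rcos_join[OF N] N.rcos_sum)
  moreover have "N #> (a \<Or> b) = N #> (b \<Or> a)" if "a \<in> carrier X" "b \<in> carrier X" for a b
    using that by (simp add: join_comm)
  ultimately show ?thesis
    unfolding lattice_ordered_group_def lattice_ordered_group_axioms_def
    by (auto simp del: lg_quot_simps simp add: join_assoc mult_join join_mult)
qed

lemma lg_quot_hom:
  assumes N: "lg_ideal N X"
  shows "(\<lambda>x. N #> x) \<in> lg_hom X (lg_quot X N)"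
proof -
  interpret N: normal N X
    using N by (simp add: lg_ideal_def)
  show ?thesis
    by (auto simp: lg_hom_def hom_def RCOSETS_def rcos_join[OF N] N.rcos_sum)
qed


section \<open>Ideals are exactly the kernels\<close>

lemma kernel_lg_ideal:
  assumes Y: "lattice_ordered_group Y" and h: "h \<in> lg_hom X Y"
  shows "lg_ideal (kernel X Y h) X"
proof -
  interpret Y: lattice_ordered_group Y by (rule Y)
  interpret h: group_hom X Y h
    using h by unfold_locales (auto simp: lg_hom_def)
  have hj: "\<And>x y. \<lbrakk>x \<in> carrier X; y \<in> carrier X\<rbrakk> \<Longrightarrow> h (x \<Or> y) = h x \<Or>\<^bsub>Y\<^esub> h y"
    using h by (auto simp: lg_hom_def)
  have conv: "h x = \<one>\<^bsub>Y\<^esub>"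
    if "a \<in> carrier X" "b \<in> carrier X" "x \<in> carrier X" "h a = \<one>\<^bsub>Y\<^esub>" "h b = \<one>\<^bsub>Y\<^esub>"
      "a \<Or> x = x" "x \<Or> b = b" for a b x
    using that hj[of a x] hj[of x b] Y.join_comm[of "h x" "\<one>\<^bsub>Y\<^esub>"] by simp
  show ?thesis
    using h.normal_kernel h.subgroup_kernel conv
    by (auto simp: lg_ideal_def lg_subalgebra_def lg_le_def) (auto simp: kernel_def hj)
qed

lemma lg_ideal_iff_kernel:
  "lg_ideal N X \<longleftrightarrow>
    (\<exists>(Y :: 'a set lgroup) h. lattice_ordered_group Y \<and> h \<in> lg_hom X Y \<and> N = kernel X Y h)"
proof
  assume N: "lg_ideal N X"
  then have sub: "subgroup N X"
    by (simp add: lg_ideal_def lg_subalgebra_def)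
  have "N = kernel X (lg_quot X N) (\<lambda>x. N #> x)"
    using subgroup.mem_carrier[OF sub] coset_join1[OF _ _ sub] coset_join2[OF _ sub]
    by (auto simp: kernel_def)
  with lg_quot_lattice_ordered_group[OF N] lg_quot_hom[OF N]
  show "\<exists>(Y :: 'a set lgroup) h. lattice_ordered_group Y \<and> h \<in> lg_hom X Y \<and> N = kernel X Y h"
    by blast
qed (auto intro: kernel_lg_ideal)

lemma lg_ideal_carrier: "lg_ideal (carrier X) X"
  by (simp add: lg_ideal_def lg_subalgebra_def normal_inv_iff subgroup_self)

lemma lg_ideal_Inter:
  assumes "\<And>N. N \<in> F \<Longrightarrow> lg_ideal N X" "F \<noteq> {}"
  shows "lg_ideal (\<Inter>F) X"
proof -
  have "subgroup (\<Inter>F) X"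
    using assms by (intro subgroups_Inter) (auto simp: lg_ideal_def lg_subalgebra_def)
  moreover have "a \<Or> b \<in> \<Inter>F" if "a \<in> \<Inter>F" "b \<in> \<Inter>F" for a b
    using that assms(1) by (auto simp: lg_ideal_def lg_subalgebra_def)
  moreover have "x \<otimes> h \<otimes> inv x \<in> \<Inter>F" if "x \<in> carrier X" "h \<in> \<Inter>F" for x h
    using that assms(1) by (auto simp: lg_ideal_def normal_inv_iff)
  moreover have "x \<in> \<Inter>F"
    if "a \<in> \<Inter>F" "b \<in> \<Inter>F" "x \<in> carrier X" "lg_le X a x" "lg_le X x b" for a b x
  proof
    fix N assume "N \<in> F"
    with that assms(1)[OF this] show "x \<in> N"
      unfolding lg_ideal_def by blast
  qed
  ultimately show ?thesis
    unfolding lg_ideal_def lg_subalgebra_def normal_inv_iff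
    by (intro conjI ballI impI) (assumption | elim conjE)+
qed


section \<open>Existence of the Huq commutator\<close>

lemma lg_cooperate_iff:
  assumes A: "lg_subalgebra A X" and B: "lg_subalgebra B X"
  shows "lg_cooperate A B X \<longleftrightarrow>
    (\<forall>a \<in> A. \<forall>b \<in> B. a \<otimes> b = b \<otimes> a) \<and>
    (\<forall>a \<in> A. \<forall>a' \<in> A. \<forall>b \<in> B. \<forall>b' \<in> B. (a \<Or> a') \<otimes> (b \<Or> b') = (a \<otimes> b) \<Or> (a' \<otimes> b'))"
    (is "_ \<longleftrightarrow> ?comm \<and> ?dist")
proof
  have oA: "\<one> \<in> A" and oB: "\<one> \<in> B"
    and cA: "\<And>a. a \<in> A \<Longrightarrow> a \<in> carrier X" and cB: "\<And>b. b \<in> B \<Longrightarrow> b \<in> carrier X"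
    and jA: "\<And>a a'. \<lbrakk>a \<in> A; a' \<in> A\<rbrakk> \<Longrightarrow> a \<Or> a' \<in> A"
    and jB: "\<And>a a'. \<lbrakk>a \<in> B; a' \<in> B\<rbrakk> \<Longrightarrow> a \<Or> a' \<in> B"
    using A B
    by (auto simp: lg_subalgebra_def intro: subgroup.one_closed subgroup.mem_carrier)
  {
    assume "lg_cooperate A B X"
    then obtain \<phi>
      where \<phi>: "\<phi> \<in> lg_hom (lg_prod (X\<lparr>carrier := A\<rparr>) (X\<lparr>carrier := B\<rparr>)) X"
        and l: "\<And>a. a \<in> A \<Longrightarrow> \<phi> (a, \<one>) = a" and r: "\<And>b. b \<in> B \<Longrightarrow> \<phi> (\<one>, b) = b"
      unfolding lg_cooperate_def by blast
    have mult: "\<And>a b a' b'. \<lbrakk>a \<in> A; a' \<in> A; b \<in> B; b' \<in> B\<rbrakk> \<Longrightarrow>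
        \<phi> (a \<otimes> a', b \<otimes> b') = \<phi> (a, b) \<otimes> \<phi> (a', b')"
      and join: "\<And>a b a' b'. \<lbrakk>a \<in> A; a' \<in> A; b \<in> B; b' \<in> B\<rbrakk> \<Longrightarrow>
        \<phi> (a \<Or> a', b \<Or> b') = \<phi> (a, b) \<Or> \<phi> (a', b')"
      using \<phi> by (simp_all add: lg_hom_def hom_def lg_prod_def)
    have 1: "\<phi> (a, b) = a \<otimes> b" if "a \<in> A" "b \<in> B" for a b
      using mult[of a \<one> \<one> b] that oA oB cA cB l r by simp
    have 2: "\<phi> (a, b) = b \<otimes> a" if "a \<in> A" "b \<in> B" for a b
      using mult[of \<one> a b \<one>] that oA oB cA cB l r by simp
    show "?comm \<and> ?dist"
      using 1 2 join jA jB by metis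
  next
    assume cd: "?comm \<and> ?dist"
    define \<phi> where "\<phi> = (\<lambda>(a, b). a \<otimes> b)"
    have "a \<otimes> a' \<otimes> (b \<otimes> b') = a \<otimes> b \<otimes> (a' \<otimes> b')"
      if ab: "a \<in> A" "a' \<in> A" "b \<in> B" "b' \<in> B" for a a' b b'
    proof -
      have "a' \<otimes> (b \<otimes> b') = a' \<otimes> b \<otimes> b'"
        using ab cA cB by (simp add: m_assoc)
      also have "\<dots> = b \<otimes> a' \<otimes> b'"
        using cd ab by metis
      finally show ?thesis
        using ab cA cB by (simp add: m_assoc)
    qed
    with cd have "\<phi> \<in> lg_hom (lg_prod (X\<lparr>carrier := A\<rparr>) (X\<lparr>carrier := B\<rparr>)) X"
      using cA cB by (auto simp: \<phi>_def lg_hom_def hom_def lg_prod_def)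
    then show "lg_cooperate A B X"
      unfolding lg_cooperate_def by (rule bexI[rotated]) (auto simp: \<phi>_def cA cB)
  }
qed

lemma lg_subalgebra_image:
  assumes Y: "lattice_ordered_group Y" and h: "h \<in> lg_hom X Y" and A: "lg_subalgebra A X"
  shows "lg_subalgebra (h ` A) Y"
proof -
  interpret Y: lattice_ordered_group Y by (rule Y)
  interpret h: group_hom X Y h
    using h by unfold_locales (auto simp: lg_hom_def)
  have sub: "subgroup A X" and j: "\<And>a b. \<lbrakk>a \<in> A; b \<in> A\<rbrakk> \<Longrightarrow> a \<Or> b \<in> A"
    using A by (auto simp: lg_subalgebra_def)
  have "h a \<Or>\<^bsub>Y\<^esub> h b \<in> h ` A" if ab: "a \<in> A" "b \<in> A" for a b
  proof -
    have "h (a \<Or> b) = h a \<Or>\<^bsub>Y\<^esub> h b"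
      using h ab subgroup.mem_carrier[OF sub] by (auto simp: lg_hom_def)
    with j[OF ab] show ?thesis by (metis imageI)
  qed
  with h.subgroup_img_is_subgroup[OF sub] show ?thesis
    by (auto simp: lg_subalgebra_def)
qed

lemma cooperate_modulo_iff:
  assumes N: "lg_ideal N X" and A: "lg_subalgebra A X" and B: "lg_subalgebra B X"
  shows "cooperate_modulo X A B N \<longleftrightarrow>
    (\<forall>a \<in> A. \<forall>b \<in> B. (a \<otimes> b) \<otimes> inv (b \<otimes> a) \<in> N) \<and>
    (\<forall>a \<in> A. \<forall>a' \<in> A. \<forall>b \<in> B. \<forall>b' \<in> B.
      ((a \<Or> a') \<otimes> (b \<Or> b')) \<otimes> inv ((a \<otimes> b) \<Or> (a' \<otimes> b')) \<in> N)"
proof -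
  interpret N: normal N X
    using N by (simp add: lg_ideal_def)
  interpret Q: lattice_ordered_group "lg_quot X N"
    by (rule lg_quot_lattice_ordered_group[OF N])
  have cA: "\<And>a. a \<in> A \<Longrightarrow> a \<in> carrier X" and cB: "\<And>b. b \<in> B \<Longrightarrow> b \<in> carrier X"
    using A B by (auto simp: lg_subalgebra_def intro: subgroup.mem_carrier)
  note im = lg_subalgebra_image[OF Q.lattice_ordered_group_axioms lg_quot_hom[OF N]]
  show ?thesis
    unfolding cooperate_modulo_def Q.lg_cooperate_iff[OF im[OF A] im[OF B]]
    by (simp add: cA cB N.rcos_sum rcos_join[OF N] rcos_eq_iff[OF N.subgroup_axioms])
qed

lemma huq_commutator_least:
  assumes A: "lg_subalgebra A X" and B: "lg_subalgebra B X"
  shows "lg_ideal (huq_commutator X A B) X"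
    and "cooperate_modulo X A B (huq_commutator X A B)"
    and "\<And>N. \<lbrakk>lg_ideal N X; cooperate_modulo X A B N\<rbrakk> \<Longrightarrow> huq_commutator X A B \<subseteq> N"
proof -
  define F where "F = {N. lg_ideal N X \<and> cooperate_modulo X A B N}"
  have cA: "\<And>a. a \<in> A \<Longrightarrow> a \<in> carrier X" and cB: "\<And>b. b \<in> B \<Longrightarrow> b \<in> carrier X"
    using A B by (auto simp: lg_subalgebra_def intro: subgroup.mem_carrier)
  have "cooperate_modulo X A B (carrier X)"
    by (simp add: cooperate_modulo_iff[OF lg_ideal_carrier A B] cA cB)
  then have "F \<noteq> {}"
    using lg_ideal_carrier by (auto simp: F_def)
  then have I: "lg_ideal (\<Inter>F) X"
    by (intro lg_ideal_Inter) (auto simp: F_def)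
  have C: "cooperate_modulo X A B (\<Inter>F)"
    unfolding cooperate_modulo_iff[OF I A B]
    by (auto simp: F_def cooperate_modulo_iff[OF _ A B])
  have eq: "huq_commutator X A B = \<Inter>F"
    unfolding huq_commutator_def
    by (rule Least_equality) (use I C in \<open>auto simp: F_def\<close>)
  show "lg_ideal (huq_commutator X A B) X"
    and "cooperate_modulo X A B (huq_commutator X A B)"
    and "\<And>N. \<lbrakk>lg_ideal N X; cooperate_modulo X A B N\<rbrakk> \<Longrightarrow> huq_commutator X A B \<subseteq> N"
    using I C unfolding eq by (auto simp: F_def)
qed

end

end

(* Write p for the join of x and 1. If x lies in both H and K, then cooperation modulo N, applied
   to the pairs (x, 1) and (1, x), makes p p congruent to x modulo N. Since 1 and x lie below p,
   both p and p inv(x) lie between 1 and p p inv(x), so convexity puts them, and hence x, in N.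
   Conversely, H \<inter> K itself satisfies the cooperation conditions, because they become
   trivial modulo H and modulo K. *)

theory Submission
  imports Defs
begin

context lattice_ordered_group
begin

lemma ideal_subalgebra: "lg_ideal N X \<Longrightarrow> lg_subalgebra N X"
  by (simp add: lg_ideal_def)

lemma ideal_join_closed: "\<lbrakk>lg_ideal N X; a \<in> N; b \<in> N\<rbrakk> \<Longrightarrow> a \<Or> b \<in> N"
  unfolding lg_ideal_def lg_subalgebra_def by blast

lemma ideal_Int: "\<lbrakk>lg_ideal H X; lg_ideal K X\<rbrakk> \<Longrightarrow> lg_ideal (H \<inter> K) X"
  using lg_ideal_Inter[of "{H, K}"] by auto

lemma mem_ideal_if_join_square:
  assumes N: "lg_ideal N X" and x: "x \<in> carrier X"
    and sq: "(x \<Or> \<one>) \<otimes> (x \<Or> \<one>) \<otimes> inv x \<in> N"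
  shows "x \<in> N"
proof -
  interpret N: normal N X
    using N by (simp add: lg_ideal_def)
  define p where "p = x \<Or> \<one>"
  define q where "q = p \<otimes> inv x"
  have p: "p \<in> carrier X" and q: "q \<in> carrier X"
    using x by (simp_all add: p_def q_def)
  have p1: "lg_le X \<one> p"
    using x by (simp add: p_def le_join2)
  have q1: "lg_le X \<one> q"
    using le_multr[of x p "inv x"] x by (simp add: p_def q_def le_join1)
  have pq: "p \<otimes> q \<in> N"
    using sq x p by (simp add: p_def[symmetric] q_def m_assoc)
  \<comment> \<open>Multiplying \<open>\<one> \<le> q\<close> on the left by \<open>p\<close>, and
    \<open>\<one> \<le> p\<close> on the right by \<open>q\<close>.\<close>
  have le: "lg_le X p (p \<otimes> q)" "lg_le X q (p \<otimes> q)"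
    using le_multl[OF _ q p q1] le_multr[OF _ p q p1] p q by simp_all
  have "p \<in> N" "q \<in> N"
    using N N.one_closed pq p q p1 q1 le unfolding lg_ideal_def by blast+
  \<comment> \<open>Since \<open>q = p \<otimes> inv x\<close>, this product is \<open>x\<close>
    itself.\<close>
  then have "inv q \<otimes> p \<in> N"
    by simp
  then show ?thesis
    using x p by (simp add: q_def inv_mult_group m_assoc)
qed

text \<open>The commutator is \<open>a\<close> times a conjugate of \<open>inv a\<close>, and also a
  conjugate of \<open>b\<close> times \<open>inv b\<close>, so one factor in \<open>N\<close>
  suffices.\<close>

lemma commutator_mem_normal:
  assumes "N \<lhd> X" and a: "a \<in> carrier X" and b: "b \<in> carrier X" and "a \<in> N \<or> b \<in> N"
  shows "(a \<otimes> b) \<otimes> inv (b \<otimes> a) \<in> N"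
proof -
  interpret N: normal N X by fact
  show ?thesis
    using assms(4)
  proof
    assume "a \<in> N"
    then have "a \<otimes> (b \<otimes> inv a \<otimes> inv b) \<in> N"
      using b by (simp add: N.inv_op_closed2)
    then show ?thesis
      using a b by (simp add: inv_mult_group m_assoc)
  next
    assume "b \<in> N"
    then have "(a \<otimes> b \<otimes> inv a) \<otimes> inv b \<in> N"
      using a by (simp add: N.inv_op_closed2)
    then show ?thesis
      using a b by (simp add: inv_mult_group m_assoc)
  qed
qed

text \<open>Here \<open>a\<close> and \<open>a'\<close> serve as the coefficients in
  \<open>ideal_join_cong\<close>: modulo \<open>N\<close> the join of the two products is
  \<open>b \<Or> b'\<close>, and so is \<open>(a \<Or> a') \<otimes> (b \<Or> b')\<close>.\<close>

lemma join_defect_mem_ideal_left: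
  assumes N: "lg_ideal N X" and a: "a \<in> N" "a' \<in> N" and b: "b \<in> carrier X" "b' \<in> carrier X"
  shows "((a \<Or> a') \<otimes> (b \<Or> b')) \<otimes> inv ((a \<otimes> b) \<Or> (a' \<otimes> b')) \<in> N"
proof -
  interpret N: normal N X
    using N by (simp add: lg_ideal_def)
  have "a \<Or> a' \<in> N"
    by (rule ideal_join_closed[OF N a])
  then have "(a \<Or> a') \<otimes> inv ((a \<otimes> b \<Or> a' \<otimes> b') \<otimes> inv (b \<Or> b')) \<in> N"
    using ideal_join_cong[OF N b a] by simp
  then show ?thesis
    using a b by (simp add: inv_mult_group m_assoc)
qed

text \<open>As \<open>ideal_join_cong\<close> wants coefficients on the left, \<open>b\<close> is
  moved across \<open>a\<close> by conjugation:
  \<open>a \<otimes> b = (a \<otimes> b \<otimes> inv a) \<otimes> a\<close>, and likewise for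
  \<open>a'\<close> and \<open>b'\<close>.\<close>

lemma join_defect_mem_ideal_right:
  assumes N: "lg_ideal N X" and a: "a \<in> carrier X" "a' \<in> carrier X" and b: "b \<in> N" "b' \<in> N"
  shows "((a \<Or> a') \<otimes> (b \<Or> b')) \<otimes> inv ((a \<otimes> b) \<Or> (a' \<otimes> b')) \<in> N"
proof -
  interpret N: normal N X
    using N by (simp add: lg_ideal_def)
  define s where "s = a \<Or> a'"
  define t where "t = b \<Or> b'"
  define u where "u = a \<otimes> b \<Or> a' \<otimes> b'"
  have s: "s \<in> carrier X" and u: "u \<in> carrier X"
    using a b by (simp_all add: s_def u_def)
  have t: "t \<in> N"
    unfolding t_def by (rule ideal_join_closed[OF N b])
  have "a \<otimes> b \<otimes> inv a \<in> N" "a' \<otimes> b' \<otimes> inv a' \<in> N"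
    using a b by (simp_all add: N.inv_op_closed2)
  from ideal_join_cong[OF N a this] have us: "u \<otimes> inv s \<in> N"
    using a b by (simp add: s_def u_def m_assoc)
  \<comment> \<open>The cancellation in the right-nested form that \<open>m_assoc\<close> produces
    below.\<close>
  have inv_cancel: "inv s \<otimes> (s \<otimes> inv u) = inv u"
    using s u by (simp add: m_assoc[symmetric])
  have "(s \<otimes> t \<otimes> inv s) \<otimes> inv (u \<otimes> inv s) \<in> N"
    using s t us by (simp add: N.inv_op_closed2)
  then have "s \<otimes> t \<otimes> inv u \<in> N"
    using s t u by (simp add: inv_mult_group m_assoc inv_cancel)
  then show ?thesis
    by (simp add: s_def t_def u_def)
qed

text \<open>Membership is checked in each ideal separately: \<open>H\<close> contains the left
  arguments and \<open>K\<close> the right ones.\<close>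

lemma cooperate_modulo_Int:
  assumes H: "lg_ideal H X" and K: "lg_ideal K X"
  shows "cooperate_modulo X H K (H \<inter> K)"
proof -
  have n: "H \<lhd> X" "K \<lhd> X"
    using H K by (simp_all add: lg_ideal_def)
  then have "\<And>a. a \<in> H \<Longrightarrow> a \<in> carrier X" "\<And>b. b \<in> K \<Longrightarrow> b \<in> carrier X"
    by (meson normal_imp_subgroup subgroup.mem_carrier)+
  then show ?thesis
    unfolding cooperate_modulo_iff[OF ideal_Int[OF H K] ideal_subalgebra[OF H] ideal_subalgebra[OF K]]
    by (simp add: n commutator_mem_normal
        join_defect_mem_ideal_left[OF H] join_defect_mem_ideal_right[OF K])
qed

lemma Int_subset_if_cooperate_modulo:
  assumes H: "lg_subalgebra H X" and K: "lg_subalgebra K X"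
    and N: "lg_ideal N X" and coop: "cooperate_modulo X H K N"
  shows "H \<inter> K \<subseteq> N"
proof
  fix x assume x: "x \<in> H \<inter> K"
  have oH: "\<one> \<in> H" and oK: "\<one> \<in> K" and c: "x \<in> carrier X"
    using H K x by (auto simp: lg_subalgebra_def intro: subgroup.one_closed subgroup.mem_carrier)
  \<comment> \<open>The instance \<open>a = x\<close>, \<open>a' = \<one>\<close>,
    \<open>b = \<one>\<close>, \<open>b' = x\<close>; the inverted join collapses to
    \<open>x\<close> by idempotence.\<close>
  have "((x \<Or> \<one>) \<otimes> (\<one> \<Or> x)) \<otimes> inv ((x \<otimes> \<one>) \<Or> (\<one> \<otimes> x)) \<in> N"
    using coop x oH oK unfolding cooperate_modulo_iff[OF N H K] by blast
  then have "(x \<Or> \<one>) \<otimes> (x \<Or> \<one>) \<otimes> inv x \<in> N"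
    using c by (simp add: join_comm[of \<one> x])
  then show "x \<in> N"
    by (rule mem_ideal_if_join_square[OF N c])
qed

end

theorem proposition8p6:
  fixes X :: "('a, 'm) lgroup_scheme" and H K :: "'a set"
  assumes "lattice_ordered_group X"
    and "lg_ideal H X"
    and "lg_ideal K X"
  shows "huq_commutator X H K = H \<inter> K"
proof -
  interpret lattice_ordered_group X by fact
  note H = ideal_subalgebra[OF assms(2)] and K = ideal_subalgebra[OF assms(3)]
  show ?thesis
    \<comment> \<open>Minimality against the admissible ideal \<open>H \<inter> K\<close> gives one
      inclusion; the other holds for every admissible ideal, hence for the commutator
      itself.\<close>
    using huq_commutator_least(3)[OF H K ideal_Int cooperate_modulo_Int, OF assms(2,3) assms(2,3)]
      Int_subset_if_cooperate_modulo[OF H K huq_commutator_least(1,2)[OF H K]]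
    by (rule equalityI)
qed

end
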